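(* There is no cyclic $(429,108,27)$ difference set; that is, there is no subset $D$ of size $108$ of the cyclic group $\mathbf{Z}/429\mathbf{Z}$ such that every nonzero element $g\in\mathbf{Z}/429\mathbf{Z}$ can be written as $g=d_i-d_j$ with $d_i,d_j\in D$ in exactly $27$ ways.
   Context: A $(v,k,\lambda)$ difference set in a group $G$ is a subset $D=\{d_1,\dots,d_k\}$ of $G$ such that each nonidentity element $g\in G$ can be represented as $g=d_id_j^{-1}$ in exactly $\lambda$ ways. It is cyclic when $G=\mathbf{Z}/v\mathbf{Z}$. *)

theory Defs
  imports "HOL-Algebra.Elementary_Groups"
begin

definition difference_set ::
    "('a, 'b) monoid_scheme \<Rightarrow> nat \<Rightarrow> nat \<Rightarrow> nat \<Rightarrow> 'a set \<Rightarrow> bool" where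
  "difference_set G v k l D \<longleftrightarrow>
     group G \<and> finite (carrier G) \<and> order G = v \<and>
     D \<subseteq> carrier G \<and> card D = k \<and>
     (\<forall>g \<in> carrier G - {\<one>\<^bsub>G\<^esub>}.
        card {(x, y). x \<in> D \<and> y \<in> D \<and> g = x \<otimes>\<^bsub>G\<^esub> inv\<^bsub>G\<^esub> y} = l)"

(* integer_mod_group v is the additive group on {0..<v} for v > 0, written
   multiplicatively: its product is addition modulo v. *)
definition cyclic_difference_set :: "nat \<Rightarrow> nat \<Rightarrow> nat \<Rightarrow> int set \<Rightarrow> bool" where
  "cyclic_difference_set v k l D \<longleftrightarrow> difference_set (integer_mod_group v) v k l D"

lemma cyclic_difference_set_iff:
  assumes "v > 0"
  shows "cyclic_difference_set v k l D \<longleftrightarrow>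
    D \<subseteq> {0..<int v} \<and> card D = k \<and>
    (\<forall>g \<in> {1..<int v}. card {(x, y). x \<in> D \<and> y \<in> D \<and> g = (x - y) mod int v} = l)"
proof -
  have carr: "carrier (integer_mod_group v) = {0..<int v}"
    using assms by (simp add: carrier_integer_mod_group)
  have dom: "{0..<int v} - {0} = {1..<int v}"
    by auto
  have diff: "x \<otimes>\<^bsub>integer_mod_group v\<^esub> inv\<^bsub>integer_mod_group v\<^esub> y = (x - y) mod int v"
    if "y \<in> {0..<int v}" for x y
  proof -
    have "inv\<^bsub>integer_mod_group v\<^esub> y = (- y) mod int v"
      by (rule inv_integer_mod_group) (simp only: carr that)
    then show ?thesis
      by (simp only: mult_integer_mod_group mod_add_right_eq diff_conv_add_uminus)
  qed
  have cnt: "card {(x, y). x \<in> D \<and> y \<in> D \<and>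
           g = x \<otimes>\<^bsub>integer_mod_group v\<^esub> inv\<^bsub>integer_mod_group v\<^esub> y} =
        card {(x, y). x \<in> D \<and> y \<in> D \<and> g = (x - y) mod int v}"
    if "D \<subseteq> {0..<int v}" for g
  proof (rule arg_cong[where f = card], rule Collect_cong, rule prod.case_cong, rule refl)
    fix p x y
    show "(x \<in> D \<and> y \<in> D \<and> g = x \<otimes>\<^bsub>integer_mod_group v\<^esub> inv\<^bsub>integer_mod_group v\<^esub> y) =
          (x \<in> D \<and> y \<in> D \<and> g = (x - y) mod int v)"
      using diff[of y x] subsetD[OF that, of y] by argo
  qed
  have ord: "order (integer_mod_group v) = v"
    by (simp only: order_def carr) simp
  show ?thesis
    unfolding cyclic_difference_set_def difference_set_def ord carr
      one_integer_mod_group dom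
    by (cases "D \<subseteq> {0..<int v}") (simp_all only: cnt group_integer_mod_group
      finite_atLeastLessThan_int simp_thms)
qed

end

theory Submission
  imports Defs "HOL-Number_Theory.Cong" "HOL-Library.Poly_Mapping" "HOL-Library.Numeral_Type" "HOL-Library.Product_Plus"
begin

text \<open>
  Split \<open>\<int>/429 = \<int>/3 \<times> (\<int>/11 \<times> \<int>/13)\<close> and apply a nontrivial character of \<open>\<int>/3\<close>. A difference set
  becomes an element A of \<open>\<int>[\<omega>][\<int>/11 \<times> \<int>/13]\<close>, \<open>\<omega>\<close> a primitive cube root of unity, with
  \<open>A A\<^sup>* = 81\<close> whose coefficients are sums of distinct cube roots of unity, hence 0 or units.

  The automorphism \<open>\<theta>\<close> induced by multiplication by 146 on \<open>\<int>/429\<close> conjugates the coefficients and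
  triples the group elements. It fixes every prime above 3, so \<open>\<theta>(A)\<close> and A differ by a unit of
  absolute value 1 at all characters, which must be a trivial unit. After translating A and
  scaling it by a unit, A has coefficients in \<open>{-1, 0, 1}\<close>, constant on the orbits of multiplication
  by 3 in each of the two factors. Counting the weights of A and of its projections to \<open>\<int>/11\<close> and
  \<open>\<int>/13\<close> forces the projection to \<open>\<int>/13\<close> to vanish at 0 and to take the values 5, -1, -1, 0 in some order on
  the four other orbits, and such a function has a nonzero autocorrelation at 1.

  That \<open>\<theta>\<close> fixes the primes above 3 is used without ideal theory: if \<open>\<pi> = 1 - \<omega>\<close> then \<open>\<theta>(X) \<equiv> X\<^sup>3\<close>
  modulo \<open>\<pi>\<close>, and together with the finite order of \<open>\<theta>\<close> this shows that \<open>\<pi>\<^sup>a | X Y\<close> implies \<open>\<pi>\<^sup>a | \<theta>(X) Y\<close>.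
\<close>

section \<open>Frobenius lifts\<close>

lemma dvd_cong_trans: "(p::'a::comm_ring_1) dvd x - y \<Longrightarrow> p dvd y - z \<Longrightarrow> p dvd x - z"
  using dvd_add[of p "x - y" "y - z"] by simp

lemma dvd_diff_mult:
  fixes p :: "'a::comm_ring_1"
  assumes "p dvd x - y" "p dvd x' - y'"
  shows "p dvd x * x' - y * y'"
proof -
  have "x * x' - y * y' = (x - y) * x' + y * (x' - y')" by (simp add: algebra_simps)
  then show ?thesis using assms by simp
qed

lemma dvd_diff_power:
  fixes p :: "'a::comm_ring_1"
  assumes "p dvd x - y"
  shows "p dvd x ^ n - y ^ n"
  by (induction n) (auto intro: dvd_diff_mult[OF assms])

text \<open>Each cubing gains a factor p: u^3 - v^3 is u - v times u^2 + uv + v^2, and the second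
  factor is congruent to 3v^2, hence to 0, modulo p.\<close>

lemma power_dvd_diff_power_3_power:
  fixes p :: "'a::comm_ring_1"
  assumes "p dvd 3" "p dvd x - y"
  shows "p ^ Suc n dvd x ^ 3 ^ n - y ^ 3 ^ n"
proof (induction n)
  case 0
  then show ?case using assms by simp
next
  case (Suc n)
  define u v where "u = x ^ 3 ^ n" and "v = y ^ 3 ^ n"
  have "p ^ Suc n dvd u - v" using Suc unfolding u_def v_def .
  moreover have "p dvd u - v" unfolding u_def v_def by (rule dvd_diff_power[OF assms(2)])
  then have "p dvd (u - v) * (u + 2 * v) + 3 * v\<^sup>2" using assms(1) by simp
  ultimately have "p ^ Suc n * p dvd (u - v) * ((u - v) * (u + 2 * v) + 3 * v\<^sup>2)"
    by (rule mult_dvd_mono)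
  also have "(u - v) * ((u - v) * (u + 2 * v) + 3 * v\<^sup>2) = u ^ 3 - v ^ 3"
    by (simp add: power2_eq_square power3_eq_cube algebra_simps)
  finally show ?case
    by (simp add: u_def v_def power_mult[symmetric] mult.commute)
qed

text \<open>The intended ring has zero divisors, so cancellation is assumed for \<open>p\<close>
  only. Together with \<open>frobenius\<close>, \<open>period\<close> makes every x congruent to a
  higher power of itself modulo p, the source of the idempotent used below.\<close>

locale frobenius_lift =
  fixes p :: "'a::comm_ring_1" and \<theta> :: "'a \<Rightarrow> 'a" and k :: nat
  assumes cancel: "p * x = p * y \<Longrightarrow> x = y"
    and p_dvd_3: "p dvd 3"
    and add: "\<theta> (x + y) = \<theta> x + \<theta> y"
    and mult: "\<theta> (x * y) = \<theta> x * \<theta> y"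
    and one: "\<theta> 1 = 1"
    and p_dvd: "p dvd \<theta> p"
    and frobenius: "p dvd \<theta> x - x ^ 3"
    and k_pos: "k > 0"
    and period: "(\<theta> ^^ k) x = x"
begin

lemma power: "\<theta> (x ^ n) = \<theta> x ^ n"
  by (induction n) (simp_all add: one mult)

lemma iterate_cong: "p dvd (\<theta> ^^ n) x - x ^ 3 ^ n"
proof (induction n)
  case (Suc n)
  have "p dvd \<theta> ((\<theta> ^^ n) x) - ((\<theta> ^^ n) x) ^ 3" by (rule frobenius)
  moreover have "p dvd ((\<theta> ^^ n) x) ^ 3 - (x ^ 3 ^ n) ^ 3" by (rule dvd_diff_power[OF Suc])
  ultimately have "p dvd \<theta> ((\<theta> ^^ n) x) - (x ^ 3 ^ n) ^ 3" by (rule dvd_cong_trans)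
  then show ?case by (simp add: power_mult[symmetric] mult.commute)
qed simp

text \<open>Modulo a power of p, the power e of x below is an idempotent fixed by \<open>\<theta>\<close>. It splits x into
  \<open>e x\<close> and a part divisible by p, to which the induction hypothesis applies.\<close>

lemma power_dvd_image_mult:
  assumes "p ^ a dvd x * y"
  shows "p ^ a dvd \<theta> x * y"
  using assms
proof (induction a arbitrary: x)
  case (Suc a)
  \<comment> \<open>After k iterations x is congruent to x^(q+2) modulo p. So U = x^(q+1) satisfies
    U x = x and U^2 = U modulo p.\<close>
  define q where "q = (3::nat) ^ k - 2"
  have "(3::nat) ^ 1 \<le> 3 ^ k" using k_pos by (intro power_increasing) auto
  then have q: "3 ^ k = Suc (Suc q)" by (simp add: q_def)
  define U where "U = x ^ Suc q"
  define e where "e = U ^ 3 ^ a"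
  have xq: "p dvd x - x ^ Suc (Suc q)" using iterate_cong[of k x] by (simp add: period q)
  have U2: "p dvd U - U ^ 2"
  proof -
    have "U - U ^ 2 = (x - x ^ Suc (Suc q)) * x ^ q"
      by (simp add: U_def power2_eq_square algebra_simps power_add)
    then show ?thesis using xq by simp
  qed
  have Un: "p dvd U - U ^ Suc n" for n
  proof (induction n)
    case (Suc n)
    have "p dvd U * U - U * U ^ Suc n" using dvd_mult[OF Suc, of U] by (simp add: algebra_simps)
    then have "p dvd U ^ 2 - U ^ Suc (Suc n)" by (simp add: power2_eq_square)
    with U2 show ?case by (rule dvd_cong_trans)
  qed simp
  have "p dvd U ^ 3 - \<theta> U" using frobenius[of U] by (metis dvd_minus_iff minus_diff_eq)
  moreover have "p dvd U - U ^ 3" using Un[of 2] by (simp only: numeral_3_eq_3 numeral_2_eq_2)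
  ultimately have "p dvd U - \<theta> U" by (rule dvd_cong_trans[rotated])
  \<comment> \<open>U and \<open>\<theta> U\<close> agree modulo p, so their a-fold cubes agree
    modulo p^(a+1).\<close>
  then have e_inv: "p ^ Suc a dvd e - \<theta> e"
    unfolding e_def power by (rule power_dvd_diff_power_3_power[OF p_dvd_3])
  obtain m where m: "(3::nat) ^ a = Suc m" using not0_implies_Suc[of "3 ^ a"] by auto
  have "p dvd (U - e) * x" unfolding e_def m using Un by (rule dvd_mult2)
  moreover have "p dvd x - U * x" using xq by (simp add: U_def mult.commute)
  ultimately have "p dvd (x - U * x) + (U - e) * x" by (rule dvd_add[rotated])
  then have "p dvd x - e * x" by (simp add: algebra_simps)
  then obtain z where z: "x - e * x = p * z" ..
  have "e = (x ^ q * U ^ m) * x" by (simp add: e_def m U_def mult_ac)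
  then obtain w where w: "e = w * x" ..
  have "p ^ Suc a dvd (x * y) * (1 - e)" using Suc.prems by (rule dvd_mult2)
  also have "(x * y) * (1 - e) = (x - e * x) * y" by (simp add: algebra_simps)
  finally have "p * p ^ a dvd p * (z * y)" by (simp add: z mult.assoc)
  then obtain t where "p * (z * y) = p * (p ^ a * t)" by (auto simp: mult.assoc)
  then have "z * y = p ^ a * t" by (rule cancel)
  then have "p ^ a dvd z * y" by (rule dvdI)
  then have "p ^ a dvd \<theta> z * y" by (rule Suc.IH)
  with p_dvd have "p * p ^ a dvd \<theta> p * (\<theta> z * y)" by (rule mult_dvd_mono)
  also have "\<theta> p * (\<theta> z * y) = \<theta> (x - e * x) * y" by (simp add: z mult mult.assoc)
  also have "\<theta> (x - e * x) = \<theta> x - \<theta> e * \<theta> x"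
    using add[of "x - e * x" "e * x"] by (metis mult diff_add_cancel add_diff_cancel_right')
  finally have "p ^ Suc a dvd (\<theta> x - \<theta> e * \<theta> x) * y" by simp
  \<comment> \<open>What remains is \<open>\<theta> e * \<theta> x * y\<close>. Replacing
    \<open>\<theta> e\<close> by \<open>e = w * x\<close> turns it into a multiple of
    \<open>x * y\<close>.\<close>
  moreover have "p ^ Suc a dvd - ((e - \<theta> e) * (\<theta> x * y))" using e_inv by simp
  moreover have "p ^ Suc a dvd (x * y) * (w * \<theta> x)" using Suc.prems by (rule dvd_mult2)
  ultimately have "p ^ Suc a dvd (\<theta> x - \<theta> e * \<theta> x) * y + - ((e - \<theta> e) * (\<theta> x * y)) + (x * y) * (w * \<theta> x)"
    by (intro dvd_add)
  also have "(\<theta> x - \<theta> e * \<theta> x) * y + - ((e - \<theta> e) * (\<theta> x * y)) + (x * y) * (w * \<theta> x)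
      = \<theta> x * y - (e - w * x) * (\<theta> x * y)"
    by (simp add: algebra_simps)
  finally show ?case using w by simp
qed simp

lemma cancel_power: "p ^ n * x = p ^ n * y \<Longrightarrow> x = y"
  by (induction n) (auto simp: mult.assoc dest: cancel)

end

section \<open>Eisenstein integers\<close>

text \<open>\<open>Eis a b\<close> stands for a + b\<omega>; the product below comes from \<omega>^2
  = -1 - \<omega>.\<close>

datatype eisenstein = Eis (fst_part: int) (omega_part: int)

instantiation eisenstein :: comm_ring_1
begin

definition "0 = Eis 0 0"
definition "1 = Eis 1 0"
definition "x + y = Eis (fst_part x + fst_part y) (omega_part x + omega_part y)"
definition "- x = Eis (- fst_part x) (- omega_part x)"
definition "x - y = Eis (fst_part x - fst_part y) (omega_part x - omega_part y)"
definition "x * y = Eis (fst_part x * fst_part y - omega_part x * omega_part y)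
   (fst_part x * omega_part y + omega_part x * fst_part y - omega_part x * omega_part y)"

instance
  by standard
    (simp_all add: zero_eisenstein_def one_eisenstein_def plus_eisenstein_def uminus_eisenstein_def
      minus_eisenstein_def times_eisenstein_def algebra_simps)

end

lemmas eisenstein_simps = plus_eisenstein_def uminus_eisenstein_def minus_eisenstein_def
  times_eisenstein_def zero_eisenstein_def one_eisenstein_def

lemma of_nat_eisenstein: "of_nat n = Eis (int n) 0"
  by (induction n) (simp_all add: eisenstein_simps)

lemma numeral_eisenstein: "numeral w = Eis (numeral w) 0"
  using of_nat_eisenstein[of "numeral w"] by simp

definition omega :: eisenstein where "omega = Eis 0 1"

definition eis_conj :: "eisenstein \<Rightarrow> eisenstein" where
  "eis_conj x = Eis (fst_part x - omega_part x) (- omega_part x)"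

text \<open>The squared complex absolute value of a + b\<omega>.\<close>

definition eis_norm :: "eisenstein \<Rightarrow> int" where
  "eis_norm x = (fst_part x)\<^sup>2 - fst_part x * omega_part x + (omega_part x)\<^sup>2"

lemma eis_conj_add: "eis_conj (x + y) = eis_conj x + eis_conj y"
  and eis_conj_mult: "eis_conj (x * y) = eis_conj x * eis_conj y"
  and eis_conj_0 [simp]: "eis_conj 0 = 0"
  and eis_conj_1 [simp]: "eis_conj 1 = 1"
  and eis_conj_conj [simp]: "eis_conj (eis_conj x) = x"
  by (simp_all add: eis_conj_def eisenstein_simps algebra_simps)

lemma eis_conj_numeral [simp]: "eis_conj (numeral w) = numeral w"
  by (simp add: eis_conj_def numeral_eisenstein)

lemma mult_eis_conj: "x * eis_conj x = Eis (eis_norm x) 0"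
  by (simp add: eis_conj_def eis_norm_def eisenstein_simps power2_eq_square algebra_simps)

lemma eis_norm_mult: "eis_norm (x * y) = eis_norm x * eis_norm y"
  by (simp add: eis_norm_def eisenstein_simps power2_eq_square algebra_simps)

lemma eis_norm_conj [simp]: "eis_norm (eis_conj x) = eis_norm x"
  by (simp add: eis_norm_def eis_conj_def power2_eq_square algebra_simps)

lemma eis_conj_eq_self: "eis_conj x = x \<Longrightarrow> x = Eis (fst_part x) 0"
  by (cases x) (simp add: eis_conj_def)

lemma eis_norm_nonneg: "eis_norm x \<ge> 0"
proof -
  have "4 * eis_norm x = (2 * fst_part x - omega_part x)\<^sup>2 + 3 * (omega_part x)\<^sup>2"
    by (simp add: eis_norm_def power2_eq_square algebra_simps)
  then show ?thesis using zero_le_power2[of "2 * fst_part x - omega_part x"] zero_le_power2[of "omega_part x"]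
    by linarith
qed

lemma eis_norm_eq_0_iff: "eis_norm x = 0 \<longleftrightarrow> x = 0"
proof
  assume "eis_norm x = 0"
  have "4 * eis_norm x = (2 * fst_part x - omega_part x)\<^sup>2 + 3 * (omega_part x)\<^sup>2"
    by (simp add: eis_norm_def power2_eq_square algebra_simps)
  then have "(2 * fst_part x - omega_part x)\<^sup>2 = 0" "(omega_part x)\<^sup>2 = 0"
    using \<open>eis_norm x = 0\<close> zero_le_power2[of "2 * fst_part x - omega_part x"] zero_le_power2[of "omega_part x"]
    by linarith+
  then show "x = 0" by (cases x) (simp add: eisenstein_simps)
qed (simp add: eis_norm_def eisenstein_simps)

lemma omega_pow_3: "omega ^ 3 = 1"
  by (simp add: omega_def eisenstein_simps power3_eq_cube)

text \<open>One cube root of unity is a unit, two distinct ones add up to minus the third, and all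
  three add up to 0. The exponents are 2j because 143 is 2 modulo 3.\<close>

lemma eis_norm_omega_sum:
  assumes "J \<subseteq> {0,1,2}"
  shows "eis_norm (\<Sum>j\<in>J. omega ^ (2 * j)) \<le> 1"
proof -
  have "J \<in> Pow {0,1,2}" using assms by simp
  then show ?thesis
    by (simp add: Pow_insert) (elim disjE; simp add: omega_def eis_norm_def eisenstein_simps eval_nat_numeral)
qed


text \<open>The residue field of 1 - \<omega> has three elements, and \<omega> reduces to 1 in
  it.\<close>

lemma one_minus_omega_dvd_iff: "1 - omega dvd z \<longleftrightarrow> 3 dvd fst_part z + omega_part z"
proof
  assume "1 - omega dvd z"
  then obtain w where "z = (1 - omega) * w" ..
  then have "fst_part z + omega_part z = 3 * omega_part w" by (simp add: omega_def eisenstein_simps)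
  then show "3 dvd fst_part z + omega_part z" by simp
next
  assume "3 dvd fst_part z + omega_part z"
  then obtain q where "fst_part z + omega_part z = 3 * q" ..
  then have "z = (1 - omega) * Eis (fst_part z - q) q"
    by (cases z) (simp add: omega_def eisenstein_simps)
  then show "1 - omega dvd z" by (rule dvdI)
qed

lemma one_minus_omega_dvd_3: "1 - omega dvd 3"
  by (simp add: one_minus_omega_dvd_iff numeral_eisenstein)

lemma three_dvd_cube_diff: "3 dvd (a::int) ^ 3 - a"
proof -
  have "a mod 3 = 0 \<or> a mod 3 = 1 \<or> a mod 3 = 2" by presburger
  moreover have "a ^ 3 mod 3 = (a mod 3) ^ 3 mod 3" by (simp add: power_mod)
  ultimately have "a ^ 3 mod 3 = a mod 3" by auto
  then show ?thesis by (simp add: mod_eq_dvd_iff)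
qed

text \<open>Conjugation and cubing both induce the identity on the residue field with three
  elements.\<close>

lemma eis_conj_frobenius: "1 - omega dvd eis_conj c - c ^ 3"
proof -
  obtain a b where c: "c = Eis a b" by (cases c)
  have "fst_part (eis_conj c - c ^ 3) + omega_part (eis_conj c - c ^ 3)
      = - (a ^ 3 - a) - (b ^ 3 - b) - 3 * (b + a ^ 2 * b - 2 * a * b ^ 2)"
    by (simp add: c eis_conj_def eisenstein_simps power2_eq_square power3_eq_cube algebra_simps)
  moreover have "3 dvd - (a ^ 3 - a)" "3 dvd b ^ 3 - b"
    using three_dvd_cube_diff[of a] three_dvd_cube_diff[of b] by (simp_all only: dvd_minus_iff)
  then have "3 dvd - (a ^ 3 - a) - (b ^ 3 - b) - 3 * (b + a ^ 2 * b - 2 * a * b ^ 2)"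
    by (rule dvd_diff[OF dvd_diff dvd_triv_left])
  ultimately show ?thesis by (simp only: one_minus_omega_dvd_iff)
qed

lemma one_minus_omega_cancel:
  assumes "(1 - omega) * x = (1 - omega) * y"
  shows "x = y"
  using assms by (cases x; cases y) (simp add: omega_def eisenstein_simps)

text \<open>The square of 1 - \<omega> is -3\<omega>, whose fourth power is 81\<omega>^4.\<close>

lemma one_minus_omega_pow_8: "(1 - omega) ^ 8 = 81 * omega"
  by (simp add: omega_def eisenstein_simps numeral_eisenstein eval_nat_numeral)

section \<open>The group ring\<close>

abbreviation lookup where "lookup \<equiv> Poly_Mapping.lookup"

text \<open>The conjugate-linear extension of k.\<close>

definition star_map :: "('g \<Rightarrow> 'g) \<Rightarrow> ('g::{ab_group_add,finite} \<Rightarrow>\<^sub>0 eisenstein) \<Rightarrow> ('g \<Rightarrow>\<^sub>0 eisenstein)" where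
  "star_map k X = (\<Sum>g\<in>UNIV. Poly_Mapping.single (k g) (eis_conj (lookup X g)))"

lemma star_map_add: "star_map k (X + Y) = star_map k X + star_map k Y"
  by (simp add: star_map_def lookup_add eis_conj_add single_add sum.distrib)

lemma star_map_zero [simp]: "star_map k 0 = 0"
  by (simp add: star_map_def)

lemma star_map_sum: "star_map k (\<Sum>i\<in>I. X i) = (\<Sum>i\<in>I. star_map k (X i))"
  by (induction I rule: infinite_finite_induct) (simp_all add: star_map_add)

lemma star_map_single [simp]:
  "star_map k (Poly_Mapping.single g x) = Poly_Mapping.single (k g) (eis_conj x)"
proof -
  have "star_map k (Poly_Mapping.single g x)
    = (\<Sum>h\<in>UNIV. if g = h then Poly_Mapping.single (k g) (eis_conj x) else 0)"
    unfolding star_map_def by (rule sum.cong) (auto simp: lookup_single when_def)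
  then show ?thesis by simp
qed

lemma sum_singles: "(\<Sum>g\<in>UNIV. Poly_Mapping.single g (lookup X g)) = (X :: 'g::finite \<Rightarrow>\<^sub>0 'b::comm_monoid_add)"
  by (rule poly_mapping_eqI) (simp add: lookup_sum lookup_single when_def)

lemma group_ring_induct [case_names single add]:
  fixes X :: "'g::finite \<Rightarrow>\<^sub>0 'b::comm_monoid_add"
  assumes single: "\<And>g x. P (Poly_Mapping.single g x)"
    and add: "\<And>X Y. P X \<Longrightarrow> P Y \<Longrightarrow> P (X + Y)"
  shows "P X"
proof -
  have "P (\<Sum>g\<in>S. Poly_Mapping.single g (lookup X g))" for S
  proof (induction S rule: infinite_finite_induct)
    case (insert g S)
    then show ?case by (simp add: single add)
  next
    case empty
    show ?case using single[of undefined 0] by simp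
  qed simp
  then show ?thesis using sum_singles[of X] by metis
qed

lemma star_map_mult:
  assumes "\<And>g h. k (g + h) = k g + k h"
  shows "star_map k (X * Y) = star_map k X * star_map k Y"
proof (induction X rule: group_ring_induct)
  case (single g x)
  show ?case
    by (induction Y rule: group_ring_induct)
      (simp_all add: mult_single assms eis_conj_mult distrib_left star_map_add)
qed (simp add: distrib_right star_map_add)

lemma lookup_star_map:
  assumes "inj k"
  shows "lookup (star_map k X) (k g) = eis_conj (lookup X g)"
  by (simp add: star_map_def lookup_sum lookup_single when_def inj_eq[OF assms])

lemma lookup_group_ring_mult:
  fixes X Y :: "'g::{ab_group_add,finite} \<Rightarrow>\<^sub>0 'b::comm_ring_1"
  shows "lookup (X * Y) g = (\<Sum>h\<in>UNIV. lookup X h * lookup Y (g - h))"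
proof -
  have "(\<Sum>q. lookup Y q when g = h + q) = lookup Y (g - h)" for h
  proof -
    have "g = h + q \<longleftrightarrow> q = g - h" for q by (auto simp: algebra_simps)
    then show ?thesis by simp
  qed
  then have "lookup (X * Y) g = (\<Sum>h. lookup X h * lookup Y (g - h))"
    by (simp add: lookup_mult)
  also have "\<dots> = (\<Sum>h\<in>UNIV. lookup X h * lookup Y (g - h))"
    by (rule Sum_any.expand_superset) auto
  finally show ?thesis .
qed

lemma lookup_single_mult:
  fixes X :: "'g::{ab_group_add,finite} \<Rightarrow>\<^sub>0 'b::comm_ring_1"
  shows "lookup (Poly_Mapping.single a x * X) g = x * lookup X (g - a)"
proof -
  have "lookup (Poly_Mapping.single a x * X) g = (\<Sum>h\<in>UNIV. if a = h then x * lookup X (g - a) else 0)"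
    unfolding lookup_group_ring_mult by (rule sum.cong) (auto simp: lookup_single when_def)
  then show ?thesis by simp
qed

section \<open>The involution, the automorphism \<theta> and the multiplier\<close>

abbreviation star :: "('g::{ab_group_add,finite} \<Rightarrow>\<^sub>0 eisenstein) \<Rightarrow> ('g \<Rightarrow>\<^sub>0 eisenstein)" where
  "star \<equiv> star_map uminus"

definition triple :: "'g::ab_group_add \<Rightarrow> 'g" where
  "triple g = g + g + g"

abbreviation theta :: "('g::{ab_group_add,finite} \<Rightarrow>\<^sub>0 eisenstein) \<Rightarrow> ('g \<Rightarrow>\<^sub>0 eisenstein)" where
  "theta \<equiv> star_map triple"

lemma triple_add: "triple (g + h) = triple g + triple h"
  by (simp add: triple_def algebra_simps)

lemma triple_eq: "triple g = (3 * fst g, 3 * snd g)" for g :: "11 \<times> 13"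
  by (simp add: triple_def prod_eq_iff)

lemma inj_triple: "inj (triple :: 11 \<times> 13 \<Rightarrow> _)"
proof (rule injI)
  fix g h :: "11 \<times> 13"
  assume "triple g = triple h"
  then have "3 * fst g = 3 * fst h" "3 * snd g = 3 * snd h" by (simp_all add: triple_eq)
  then have "4 * 3 * fst g = 4 * 3 * fst h" "9 * 3 * snd g = 9 * 3 * snd h" by (simp_all only: mult.assoc)
  moreover have "(4::11) * 3 = 1" "(9::13) * 3 = 1" by simp_all
  ultimately show "g = h" by (simp only: mult_1 prod_eq_iff)
qed

lemma star_mult: "star (X * Y) = star X * star Y"
  by (rule star_map_mult) simp

lemma star_star: "star (star X) = X"
  by (induction X rule: group_ring_induct) (simp_all add: star_map_add)

lemma theta_star: "theta (star X) = star (theta X)"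
  by (induction X rule: group_ring_induct) (simp_all add: star_map_add triple_def)

lemma lookup_star: "lookup (star X) g = eis_conj (lookup X (- g))"
  using lookup_star_map[of uminus X "- g"] by simp

lemma lookup_mult_star:
  "lookup (X * star X) g = (\<Sum>h\<in>UNIV. lookup X h * eis_conj (lookup X (h - g)))"
  by (simp add: lookup_group_ring_mult lookup_star)

lemma sum_Eis_zero: "(\<Sum>i\<in>S. Eis (a i) 0) = Eis (\<Sum>i\<in>S. a i) 0"
  by (induction S rule: infinite_finite_induct) (simp_all add: eisenstein_simps)

lemma sum_norm_lookup: "lookup (X * star X) 0 = Eis (\<Sum>h\<in>UNIV. eis_norm (lookup X h)) 0"
  by (simp add: lookup_mult_star mult_eis_conj sum_Eis_zero)

text \<open>The coefficient of \<open>F * star F\<close> at 0 is the sum of the norms of the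
  coefficients of F. Nonnegative integers with sum 1 leave room for a single nonzero
  coefficient.\<close>

lemma mult_star_eq_one:
  assumes "F * star F = 1"
  shows "\<exists>g x. F = Poly_Mapping.single g x \<and> eis_norm x = 1"
proof -
  have sum1: "(\<Sum>h\<in>UNIV. eis_norm (lookup F h)) = 1"
    using sum_norm_lookup[of F] by (simp add: assms one_eisenstein_def)
  then obtain g where g: "eis_norm (lookup F g) \<noteq> 0"
    by (metis sum.neutral zero_neq_one)
  have "(\<Sum>h\<in>UNIV. eis_norm (lookup F h))
      = eis_norm (lookup F g) + (\<Sum>h\<in>UNIV - {g}. eis_norm (lookup F h))"
    by (rule sum.remove) auto
  moreover have "(\<Sum>h\<in>UNIV - {g}. eis_norm (lookup F h)) \<ge> 0"
    by (rule sum_nonneg) (rule eis_norm_nonneg)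
  ultimately have g1: "eis_norm (lookup F g) = 1" and "(\<Sum>h\<in>UNIV - {g}. eis_norm (lookup F h)) = 0"
    using sum1 g eis_norm_nonneg[of "lookup F g"] by linarith+
  then have "\<forall>h\<in>UNIV - {g}. eis_norm (lookup F h) = 0"
    by (subst (asm) sum_nonneg_eq_0_iff) (auto intro: eis_norm_nonneg)
  then have "F = Poly_Mapping.single g (lookup F g)"
    by (intro poly_mapping_eqI) (auto simp: lookup_single when_def eis_norm_eq_0_iff)
  with g1 show ?thesis by blast
qed

text \<open>For monomials this is the congruence of the coefficients; it extends to sums because the
  mixed terms of a cube are multiples of 3.\<close>

lemma theta_frobenius: "Poly_Mapping.single 0 (1 - omega) dvd theta X - X ^ 3"
proof (induction X rule: group_ring_induct)
  case (single g x)
  obtain w where w: "eis_conj x - x ^ 3 = (1 - omega) * w" using eis_conj_frobenius[of x] ..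
  have "Poly_Mapping.single g x ^ 3 = Poly_Mapping.single (triple g) (x ^ 3)"
    by (simp add: power3_eq_cube mult_single triple_def)
  then have "theta (Poly_Mapping.single g x) - Poly_Mapping.single g x ^ 3
      = Poly_Mapping.single (triple g) (eis_conj x - x ^ 3)"
    by (simp add: single_diff)
  also have "\<dots> = Poly_Mapping.single 0 (1 - omega) * Poly_Mapping.single (triple g) w"
    by (simp add: w mult_single)
  finally show ?case by simp
next
  case (add X Y)
  obtain w where w: "3 = (1 - omega) * w" using one_minus_omega_dvd_3 ..
  have "3 = Poly_Mapping.single 0 (1 - omega) * Poly_Mapping.single (0::'a) w"
    by (simp add: mult_single w[symmetric])
  then have "Poly_Mapping.single (0::'a) (1 - omega) dvd 3" by (rule dvdI)
  then have "Poly_Mapping.single 0 (1 - omega) dvd (theta X - X ^ 3) + (theta Y - Y ^ 3) - 3 * (X * X * Y + X * Y * Y)"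
    using add by simp
  also have "(theta X - X ^ 3) + (theta Y - Y ^ 3) - 3 * (X * X * Y + X * Y * Y) = theta (X + Y) - (X + Y) ^ 3"
    by (simp add: star_map_add power3_eq_cube algebra_simps)
  finally show ?case .
qed

lemma triple_funpow: "(triple ^^ n) g = ((3::11) ^ n * fst g, (3::13) ^ n * snd g)"
  by (induction n) (simp_all add: triple_def prod_eq_iff algebra_simps)

text \<open>Multiplication by 3 has order 5 modulo 11 and order 3 modulo 13, and conjugation has
  order 2.\<close>

lemma theta_funpow_30: "(theta ^^ 30) X = (X :: 11 \<times> 13 \<Rightarrow>\<^sub>0 eisenstein)"
proof (induction X rule: group_ring_induct)
  case (single g x)
  have "(theta ^^ n) (Poly_Mapping.single g x) = Poly_Mapping.single ((triple ^^ n) g) ((eis_conj ^^ n) x)" for n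
    by (induction n) simp_all
  moreover have "(eis_conj ^^ 30) x = x" by (simp add: numeral_eq_Suc)
  moreover have "(3::11) ^ 30 = 1" "(3::13) ^ 30 = 1" by simp_all
  then have "(triple ^^ 30) g = g" unfolding triple_funpow by (simp only: mult_1 prod.collapse)
  ultimately show ?case by simp
next
  case (add X Y)
  have "(theta ^^ n) (X + Y) = (theta ^^ n) X + (theta ^^ n) Y" for n
    by (induction n) (simp_all add: star_map_add)
  with add show ?case by simp
qed

interpretation theta: frobenius_lift "Poly_Mapping.single 0 (1 - omega)" "theta :: (11 \<times> 13 \<Rightarrow>\<^sub>0 eisenstein) \<Rightarrow> _" 30
proof
  let ?p = "Poly_Mapping.single 0 (1 - omega) :: 11 \<times> 13 \<Rightarrow>\<^sub>0 eisenstein"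
  fix X Y :: "11 \<times> 13 \<Rightarrow>\<^sub>0 eisenstein"
  show "X = Y" if "?p * X = ?p * Y"
  proof (rule poly_mapping_eqI)
    fix g
    have "lookup (?p * X) g = lookup (?p * Y) g" using that by simp
    then show "lookup X g = lookup Y g" by (simp add: lookup_single_mult one_minus_omega_cancel)
  qed
  have dvd_single: "?p dvd Poly_Mapping.single g x" if x: "1 - omega dvd x" for g x
  proof -
    obtain w where "x = (1 - omega) * w" using x ..
    then have "Poly_Mapping.single g x = ?p * Poly_Mapping.single g w" by (simp add: mult_single)
    then show ?thesis by (rule dvdI)
  qed
  show "?p dvd 3" using dvd_single[OF one_minus_omega_dvd_3, of 0] by simp
  have "1 - omega dvd eis_conj (1 - omega)"
    by (simp only: one_minus_omega_dvd_iff) (simp add: eis_conj_def omega_def eisenstein_simps)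
  from dvd_single[OF this, of 0] show "?p dvd theta ?p" by (simp add: triple_def)
  show "theta 1 = (1 :: 11 \<times> 13 \<Rightarrow>\<^sub>0 eisenstein)"
    using star_map_single[of triple "0 :: 11 \<times> 13" 1] by (simp add: triple_def)
  show "(theta ^^ 30) X = X" by (rule theta_funpow_30)
qed (simp_all add: star_map_add star_map_mult triple_add theta_frobenius)

text \<open>81 is an associate of the eighth power of the prime element, and cancelling it from
  \<^term>\<open>theta A * star A\<close> leaves an element F with \<^term>\<open>F * star F = 1\<close>.\<close>

lemma multiplier:
  fixes A :: "11 \<times> 13 \<Rightarrow>\<^sub>0 eisenstein"
  assumes A: "A * star A = 81"
  shows "\<exists>g x. eis_norm x = 1 \<and> theta A = Poly_Mapping.single g x * A"
proof -
  define p :: "11 \<times> 13 \<Rightarrow>\<^sub>0 eisenstein" where "p = Poly_Mapping.single 0 (1 - omega)"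
  have single_pow: "Poly_Mapping.single 0 x ^ n = Poly_Mapping.single (0 :: 11 \<times> 13) (x ^ n)" for x :: eisenstein and n
    by (induction n) (simp_all add: mult_single)
  have omega: "81 * omega * omega ^ 2 = 81" using omega_pow_3 by (simp add: power3_eq_cube power2_eq_square mult.assoc)
  have p8: "p ^ 8 * Poly_Mapping.single 0 (omega ^ 2) = 81"
    by (simp add: p_def single_pow one_minus_omega_pow_8 mult_single omega)
  have p8': "p ^ 8 = 81 * Poly_Mapping.single 0 omega"
    using mult_single[of 0 81 "0 :: 11 \<times> 13" omega] by (simp add: p_def single_pow one_minus_omega_pow_8)
  have "p ^ 8 dvd A * star A" unfolding A p8[symmetric] by simp
  then have "p ^ 8 dvd theta A * star A" unfolding p_def by (rule theta.power_dvd_image_mult)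
  then obtain F' where "theta A * star A = p ^ 8 * F'" ..
  then obtain F where F: "theta A * star A = 81 * F" unfolding p8' by (auto simp: mult.assoc)
  have star_map_81: "star_map k 81 = 81" if "k 0 = 0" for k :: "11 \<times> 13 \<Rightarrow> 11 \<times> 13"
    using star_map_single[of k 0 81] that by simp
  have star81: "star 81 = (81 :: 11 \<times> 13 \<Rightarrow>\<^sub>0 eisenstein)" "theta 81 = (81 :: 11 \<times> 13 \<Rightarrow>\<^sub>0 eisenstein)"
    by (simp_all add: star_map_81 triple_def)
  have cancel81: "X = Y" if "81 * X = 81 * Y" for X Y :: "11 \<times> 13 \<Rightarrow>\<^sub>0 eisenstein"
  proof -
    have "p ^ 8 * X = p ^ 8 * Y" using arg_cong[OF that, of "(*) (Poly_Mapping.single 0 omega)"]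
      unfolding p8' by (simp only: mult_ac)
    then show ?thesis unfolding p_def by (rule theta.cancel_power)
  qed
  \<comment> \<open>F has absolute value 1 because \<open>theta A * star (theta A)\<close> is again
    81.\<close>
  have "81 * (81 * (F * star F)) = (81 * F) * star (81 * F)"
    by (simp add: star_mult star81 mult_ac)
  also have "\<dots> = (theta A * star A) * (star (theta A) * A)"
    unfolding F[symmetric] by (simp add: star_mult star_star)
  also have "\<dots> = theta (A * star A) * (A * star A)"
    by (simp add: star_map_mult[OF triple_add] theta_star mult_ac)
  also have "\<dots> = 81 * (81 * 1)" by (simp add: A star81)
  finally have "81 * (F * star F) = 81 * 1" by (rule cancel81)
  then have "F * star F = 1" by (rule cancel81)
  then obtain g x where gx: "F = Poly_Mapping.single g x" "eis_norm x = 1"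
    using mult_star_eq_one by blast
  \<comment> \<open>Multiplying \<open>theta A * star A = 81 * F\<close> by A exchanges
    \<open>star A\<close> for the factor 81, which cancels.\<close>
  have "81 * theta A = (A * star A) * theta A" by (simp only: A)
  also have "\<dots> = (theta A * star A) * A" by (simp only: mult_ac)
  also have "\<dots> = 81 * (F * A)" by (simp add: F mult.assoc)
  finally have "theta A = F * A" by (rule cancel81)
  with gx show ?thesis by blast
qed

section \<open>Orbit values\<close>

text \<open>Among the squares 25, 16, 1, 0, only 25 + 1 + 1 + 0 gives 27, and the sum 3 then leaves
  the orderings of 5, -1, -1, 0. The last expression is the one in \<open>correlation_13\<close>
  with value 0 at 0.\<close>

lemma thirteen_values:
  fixes b1 b2 b3 b4 :: int
  assumes "b1 \<in> {-5,-1,0,4,5}" "b2 \<in> {-5,-1,0,4,5}" "b3 \<in> {-5,-1,0,4,5}" "b4 \<in> {-5,-1,0,4,5}"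
    and "b1 + b2 + b3 + b4 = 3" "b1\<^sup>2+b2\<^sup>2+b3\<^sup>2+b4\<^sup>2 = 27"
  shows "b1*b2 + b2*b1 + b1*b3 + b3*b2 + b2*b2 + b2*b4 + b4*b4 + b4*b1 + b1*b3 + b3*b4 + b4*b3 \<noteq> 0"
  using assms by (elim insertE emptyE) simp_all

lemma sq_bound: "x\<^sup>2 \<le> (1::int) \<Longrightarrow> x = -1 \<or> x = 0 \<or> x = 1"
proof -
  assume "x\<^sup>2 \<le> 1"
  then have "\<bar>x\<bar> \<le> 1" by (simp add: abs_square_le_1)
  then show ?thesis by auto
qed

text \<open>The integers c, di, ei, xi, yi are the values of a function on \<open>\<int>/11 \<times> \<int>/13\<close> on the orbits of
  \<open>(0,0)\<close>, \<open>(0,s)\<close>, \<open>(r,0)\<close>, \<open>(1,s)\<close>, \<open>(2,s)\<close> for r = 1, 2 and s = 1, 2, 4, 7; ai and bi are the values of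
  its projections to the two factors.\<close>

lemma orbit_values_contradiction:
  fixes c e1 e2 d1 d2 d3 d4 x1 x2 x3 x4 y1 y2 y3 y4 :: int
  assumes small: "c\<^sup>2 \<le> 1" "e1\<^sup>2 \<le> 1" "e2\<^sup>2 \<le> 1"
      "d1\<^sup>2 \<le> 1" "d2\<^sup>2 \<le> 1" "d3\<^sup>2 \<le> 1" "d4\<^sup>2 \<le> 1"
    and total: "c + 3*(d1+d2+d3+d4) + 5*(e1 + 3*(x1+x2+x3+x4)) + 5*(e2 + 3*(y1+y2+y3+y4)) = 9"
    and weight: "c\<^sup>2 + 3*(d1\<^sup>2+d2\<^sup>2+d3\<^sup>2+d4\<^sup>2) + 5*(e1\<^sup>2 + 3*(x1\<^sup>2+x2\<^sup>2+x3\<^sup>2+x4\<^sup>2))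
      + 5*(e2\<^sup>2 + 3*(y1\<^sup>2+y2\<^sup>2+y3\<^sup>2+y4\<^sup>2)) = 81"
    and a0: "a0 = c + 3*(d1+d2+d3+d4)"
    and a1: "a1 = e1 + 3*(x1+x2+x3+x4)"
    and a2: "a2 = e2 + 3*(y1+y2+y3+y4)"
    and weight11: "a0\<^sup>2 + 5*a1\<^sup>2 + 5*a2\<^sup>2 = 81"
    and b0: "b0 = c + 5*e1 + 5*e2"
    and b1: "b1 = d1 + 5*x1 + 5*y1"
    and b2: "b2 = d2 + 5*x2 + 5*y2"
    and b3: "b3 = d3 + 5*x3 + 5*y3"
    and b4: "b4 = d4 + 5*x4 + 5*y4"
    and weight13: "b0\<^sup>2 + 3*(b1\<^sup>2+b2\<^sup>2+b3\<^sup>2+b4\<^sup>2) = 81"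
    and corr13: "b0*b1 + b1*b2 + b2*b1 + b1*b3 + b3*b2 + b2*b2 + b2*b4 + b4*b4 + b4*b1
      + b1*b3 + b3*b4 + b4*b3 + b3*b0 = 0"
  shows False
proof -
  have nn: "z\<^sup>2 \<ge> 0" for z :: int by simp
  have c: "c = -1 \<or> c = 0 \<or> c = 1" using small sq_bound by blast
  have e: "e1 = -1 \<or> e1 = 0 \<or> e1 = 1" "e2 = -1 \<or> e2 = 0 \<or> e2 = 1" using small sq_bound by blast+
  have d: "d1 = -1 \<or> d1 = 0 \<or> d1 = 1" "d2 = -1 \<or> d2 = 0 \<or> d2 = 1"
     "d3 = -1 \<or> d3 = 0 \<or> d3 = 1" "d4 = -1 \<or> d4 = 0 \<or> d4 = 1" using small sq_bound by blast+
  define D where "D = d1\<^sup>2+d2\<^sup>2+d3\<^sup>2+d4\<^sup>2"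
  define W where "W = x1\<^sup>2+x2\<^sup>2+x3\<^sup>2+x4\<^sup>2 + y1\<^sup>2+y2\<^sup>2+y3\<^sup>2+y4\<^sup>2"
  have D: "0 \<le> D" "D \<le> 4" using small nn[of d1] nn[of d2] nn[of d3] nn[of d4] unfolding D_def by linarith+
  have eq: "c\<^sup>2 + 5*(e1\<^sup>2+e2\<^sup>2) + 3*D + 15*W = 81" using weight unfolding D_def W_def by (simp add: algebra_simps)
  have c2: "c\<^sup>2 = 0 \<or> c\<^sup>2 = 1" using c by auto
  have E: "e1\<^sup>2 + e2\<^sup>2 = 0 \<or> e1\<^sup>2 + e2\<^sup>2 = 1 \<or> e1\<^sup>2 + e2\<^sup>2 = 2" using e by auto
  \<comment> \<open>Modulo 3 the equation gives C = E, and modulo 5 it then determines D.\<close>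
  have "(C = 1 \<and> D = 0) \<or> (C = 0 \<and> E = 0 \<and> D = 2)"
    if "C = 0 \<or> C = 1" "E = 0 \<or> E = 1 \<or> E = 2" "C + 5*E + 3*D + 15*W = 81" for C E
    using that D by presburger
  from this[OF c2 E eq] have split: "(c\<^sup>2 = 1 \<and> D = 0) \<or> (c = 0 \<and> e1 = 0 \<and> e2 = 0 \<and> D = 2)"
    by (auto simp: sum_power2_eq_zero_iff)
  have A: "9 - a0 = 5*(a1+a2)" using total unfolding a0 a1 a2 by (simp add: algebra_simps)
  have a12: "(a1 + a2)\<^sup>2 + (a1 - a2)\<^sup>2 = 2*(a1\<^sup>2 + a2\<^sup>2)" by (simp add: power2_eq_square algebra_simps)
  from split show False
  proof
    assume h: "c\<^sup>2 = 1 \<and> D = 0"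
    then have "d1\<^sup>2 = 0 \<and> d2\<^sup>2 = 0 \<and> d3\<^sup>2 = 0 \<and> d4\<^sup>2 = 0" 
      using nn[of d1] nn[of d2] nn[of d3] nn[of d4] unfolding D_def by linarith
    then have "a0 = c" using a0 by simp
    moreover have "c = 1 \<or> c = -1" using h by (simp add: power2_eq_1_iff)
    ultimately have "a0 = -1" using A by presburger
    then have "a1 + a2 = 2" "a1\<^sup>2 + a2\<^sup>2 = 16" using A weight11 by auto
    \<comment> \<open>The contradiction in this case: 28 lies strictly between the squares of 5 and
      6.\<close>
    then have sq: "(a1 - a2)\<^sup>2 = 28" using a12 by simp
    then have "\<bar>a1 - a2\<bar>\<^sup>2 = 28" by simp
    moreover have "\<bar>a1 - a2\<bar> \<le> 5 \<or> \<bar>a1 - a2\<bar> \<ge> 6" by linarith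
    ultimately show False
      using power_mono[of "\<bar>a1-a2\<bar>" 5 2] power_mono[of 6 "\<bar>a1-a2\<bar>" 2] by auto
  next
    assume h: "c = 0 \<and> e1 = 0 \<and> e2 = 0 \<and> D = 2"
    have "3 * (d1+d2+d3+d4) - 9 = -5*(a1+a2)" using A a0 h by linarith
    moreover have "-1 \<le> d1 \<and> d1 \<le> 1" "-1 \<le> d2 \<and> d2 \<le> 1" "-1 \<le> d3 \<and> d3 \<le> 1" "-1 \<le> d4 \<and> d4 \<le> 1"
      using d by auto
    then have "-4 \<le> d1+d2+d3+d4" "d1+d2+d3+d4 \<le> 4" by auto
    \<comment> \<open>The equation says that s is 3 modulo 5. The value 3 would need at least three
      nonzero di, against D = 2.\<close>
    moreover have "s = -2 \<or> s = 3" if "3*s - 9 = -5*t" "-4 \<le> s" "s \<le> 4" for s t :: int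
      using that by presburger
    ultimately have "d1+d2+d3+d4 = -2 \<or> d1+d2+d3+d4 = 3" by blast
    moreover have "d1+d2+d3+d4 \<noteq> 3" using h d unfolding D_def by (elim disjE; simp)
    ultimately have dsum: "d1+d2+d3+d4 = -2" by simp
    then have msum: "(x1+y1)+(x2+y2)+(x3+y3)+(x4+y4) = 1" using total h dsum by simp
    have bs: "b1\<^sup>2+b2\<^sup>2+b3\<^sup>2+b4\<^sup>2 = 27" using weight13 b0 h by simp
    \<comment> \<open>The list consists of the integers of absolute value at most 5 that are 0 or -1
      modulo 5.\<close>
    have pm: "b \<in> {-5,-1,0,4,5}" if "b = d + 5*x + 5*y" "b\<^sup>2 \<le> 27" "d = -1 \<or> d = 0" for b d x y :: int
    proof -
      have "\<bar>b\<bar> \<le> 5"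
      proof (rule ccontr)
        assume "\<not> ?thesis"
        then have "6^2 \<le> \<bar>b\<bar>^2" by (intro power_mono) auto
        then show False using that by simp
      qed
      then have "b = -5 \<or> b = -1 \<or> b = 0 \<or> b = 4 \<or> b = 5" using that by presburger
      then show ?thesis by simp
    qed
    \<comment> \<open>The di have sum -2 and sum of squares 2, so the nonnegative numbers di^2 + di
      all vanish and no di is 1.\<close>
    have sqd: "z\<^sup>2 + z \<ge> 0" if "z = -1 \<or> z = 0 \<or> z = 1" for z :: int using that by auto
    have "(d1\<^sup>2 + d1) + (d2\<^sup>2 + d2) + (d3\<^sup>2 + d3) + (d4\<^sup>2 + d4) = 0" using dsum h unfolding D_def by simp
    then have d0: "d1\<^sup>2 + d1 = 0" "d2\<^sup>2 + d2 = 0" "d3\<^sup>2 + d3 = 0" "d4\<^sup>2 + d4 = 0"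
      using sqd[OF d(1)] sqd[OF d(2)] sqd[OF d(3)] sqd[OF d(4)] by linarith+
    have dd: "d1 = -1 \<or> d1 = 0" "d2 = -1 \<or> d2 = 0" "d3 = -1 \<or> d3 = 0" "d4 = -1 \<or> d4 = 0"
      using d d0 by auto
    have "b1 \<in> {-5,-1,0,4,5}" "b2 \<in> {-5,-1,0,4,5}" "b3 \<in> {-5,-1,0,4,5}" "b4 \<in> {-5,-1,0,4,5}"
      using pm[OF b1 _ dd(1)] pm[OF b2 _ dd(2)] pm[OF b3 _ dd(3)] pm[OF b4 _ dd(4)]
        bs nn[of b1] nn[of b2] nn[of b3] nn[of b4] by linarith+
    moreover have "b1 + b2 + b3 + b4 = 3" using b1 b2 b3 b4 dsum msum by simp
    ultimately show False
      using thirteen_values bs corr13 h b0 by simp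
  qed
qed

section \<open>Sums and correlations of functions invariant under multiplication by 3\<close>

lemma UNIV_11: "(UNIV :: 11 set) = {0,1,2,3,4,5,6,7,8,9,10}"
  by (rule card_subset_eq[symmetric]) simp_all

lemma UNIV_13: "(UNIV :: 13 set) = {0,1,2,3,4,5,6,7,8,9,10,11,12}"
  by (rule card_subset_eq[symmetric]) simp_all

text \<open>The orbits of nonzero classes are 1, 3, 9, 5, 4 and 2, 6, 7, 10, 8, the squares and the
  nonsquares.\<close>

lemma triple_invariant_11:
  fixes h :: "11 \<Rightarrow> 'b"
  assumes "\<And>r. h (3 * r) = h r"
  shows "h 3 = h 1" "h 9 = h 1" "h 5 = h 1" "h 4 = h 1" "h 6 = h 2" "h 7 = h 2" "h 10 = h 2" "h 8 = h 2"
proof -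
  have "(3::11) = 3 * 1" "(9::11) = 3 * 3" "(5::11) = 3 * 9" "(4::11) = 3 * 5"
    "(6::11) = 3 * 2" "(7::11) = 3 * 6" "(10::11) = 3 * 7" "(8::11) = 3 * 10" by simp_all
  then show "h 3 = h 1" "h 9 = h 1" "h 5 = h 1" "h 4 = h 1" "h 6 = h 2" "h 7 = h 2" "h 10 = h 2" "h 8 = h 2"
    using assms by metis+
qed

lemma triple_invariant_13:
  fixes h :: "13 \<Rightarrow> 'b"
  assumes "\<And>r. h (3 * r) = h r"
  shows "h 3 = h 1" "h 9 = h 1" "h 6 = h 2" "h 5 = h 2" "h 12 = h 4" "h 10 = h 4" "h 8 = h 7" "h 11 = h 7"
proof -
  have "(3::13) = 3 * 1" "(9::13) = 3 * 3" "(6::13) = 3 * 2" "(5::13) = 3 * 6"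
    "(12::13) = 3 * 4" "(10::13) = 3 * 12" "(8::13) = 3 * 7" "(11::13) = 3 * 8" by simp_all
  then show "h 3 = h 1" "h 9 = h 1" "h 6 = h 2" "h 5 = h 2" "h 12 = h 4" "h 10 = h 4" "h 8 = h 7" "h 11 = h 7"
    using assms by metis+
qed

lemma sum_11:
  fixes h :: "11 \<Rightarrow> int"
  assumes "\<And>r. h (3 * r) = h r"
  shows "(\<Sum>r\<in>UNIV. h r) = h 0 + 5 * h 1 + 5 * h 2"
  unfolding UNIV_11 by (simp add: triple_invariant_11[of h, OF assms])

lemma sum_13:
  fixes h :: "13 \<Rightarrow> int"
  assumes "\<And>r. h (3 * r) = h r"
  shows "(\<Sum>r\<in>UNIV. h r) = h 0 + 3 * (h 1 + h 2 + h 4 + h 7)"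
  unfolding UNIV_13 by (simp add: triple_invariant_13[of h, OF assms])

lemma correlation_13:
  fixes h :: "13 \<Rightarrow> int"
  assumes "\<And>r. h (3 * r) = h r"
  shows "(\<Sum>s\<in>UNIV. h s * h (s + 1)) = h 0*h 1 + h 1*h 2 + h 2*h 1 + h 1*h 4 + h 4*h 2
      + h 2*h 2 + h 2*h 7 + h 7*h 7 + h 7*h 1 + h 1*h 4 + h 4*h 7 + h 7*h 4 + h 4*h 0"
proof -
  \<comment> \<open>Needed for the wrap-around term s = 12, where s + 1 appears as 13.\<close>
  have "(13::13) = 0" by simp
  then have "h 13 = h 0" by (rule arg_cong)
  then show ?thesis
    unfolding UNIV_13 by (simp add: triple_invariant_13[of h, OF assms] del: numeral_eq_iff)
qed

lemma sum_translate:
  fixes g :: "'g::{ab_group_add,finite} \<Rightarrow> 'b::comm_monoid_add"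
  shows "(\<Sum>a\<in>UNIV. g (r + a)) = (\<Sum>a\<in>UNIV. g a)"
  by (rule sum.reindex_bij_witness[of _ "\<lambda>a. a - r" "\<lambda>a. r + a"]) auto

text \<open>Summing over all shifts decouples the two factors. This yields the correlations of a
  projection from those of the function.\<close>

lemma sum_correlation:
  fixes g :: "'g::{ab_group_add,finite} \<Rightarrow> int"
  shows "(\<Sum>a\<in>UNIV. \<Sum>r\<in>UNIV. g r * h (r + a)) = (\<Sum>r\<in>UNIV. g r) * (\<Sum>r\<in>UNIV. h r)"
  by (subst sum.swap) (simp add: sum_translate sum_distrib_left[symmetric] sum_distrib_right[symmetric])

lemma no_perfect_correlation_of_sum_9:
  fixes f :: "11 \<Rightarrow> 13 \<Rightarrow> int"
  assumes inv: "\<And>r s. f (3 * r) s = f r s" "\<And>r s. f r (3 * s) = f r s"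
    and small: "\<And>r s. (f r s)\<^sup>2 \<le> 1"
    and corr: "\<And>a b. (\<Sum>r\<in>UNIV. \<Sum>s\<in>UNIV. f r s * f (r + a) (s + b)) = (if a = 0 \<and> b = 0 then 81 else 0)"
    and total: "(\<Sum>r\<in>UNIV. \<Sum>s\<in>UNIV. f r s) = 9"
  shows False
proof -
  define \<alpha> where "\<alpha> r = (\<Sum>s\<in>UNIV. f r s)" for r
  define \<beta> where "\<beta> s = (\<Sum>r\<in>UNIV. f r s)" for s
  have \<alpha>3: "\<alpha> (3 * r) = \<alpha> r" for r by (simp add: \<alpha>_def inv)
  have \<beta>3: "\<beta> (3 * s) = \<beta> s" for s by (simp add: \<beta>_def inv)
  have \<alpha>: "\<alpha> r = f r 0 + 3 * (f r 1 + f r 2 + f r 4 + f r 7)" for r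
    unfolding \<alpha>_def by (rule sum_13) (rule inv)
  have \<beta>: "\<beta> s = f 0 s + 5 * f 1 s + 5 * f 2 s" for s
    unfolding \<beta>_def by (rule sum_11) (rule inv)
  \<comment> \<open>The autocorrelation of \<alpha> at 0 collects the shifts (0, b) of f; likewise
    that of \<beta> at b below collects the shifts (a, b).\<close>
  have "(\<Sum>r\<in>UNIV. (\<alpha> r)\<^sup>2) = (\<Sum>b\<in>UNIV. \<Sum>r\<in>UNIV. \<Sum>s\<in>UNIV. f r s * f (r + 0) (s + b))"
    unfolding \<alpha>_def power2_eq_square sum_correlation[symmetric]
    by (subst sum.swap) simp
  also have "\<dots> = 81" unfolding corr by simp
  finally have weight11: "(\<Sum>r\<in>UNIV. (\<alpha> r)\<^sup>2) = 81" .
  have corr13: "(\<Sum>s\<in>UNIV. \<beta> s * \<beta> (s + b)) = (if b = 0 then 81 else 0)" for b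
  proof -
    have "(\<Sum>s\<in>UNIV. \<beta> s * \<beta> (s + b)) = (\<Sum>s\<in>UNIV. \<Sum>a\<in>UNIV. \<Sum>r\<in>UNIV. f r s * f (r + a) (s + b))"
      unfolding \<beta>_def sum_correlation[where h = "\<lambda>r. f r _"] ..
    also have "\<dots> = (\<Sum>a\<in>UNIV. \<Sum>s\<in>UNIV. \<Sum>r\<in>UNIV. f r s * f (r + a) (s + b))" by (rule sum.swap)
    also have "\<dots> = (\<Sum>a\<in>UNIV. \<Sum>r\<in>UNIV. \<Sum>s\<in>UNIV. f r s * f (r + a) (s + b))"
      by (intro sum.cong refl sum.swap)
    also have "\<dots> = (if b = 0 then 81 else 0)" unfolding corr by simp
    finally show ?thesis .
  qed
  have sq_rows: "(\<Sum>s\<in>UNIV. (f r s)\<^sup>2) = (f r 0)\<^sup>2 + 3 * ((f r 1)\<^sup>2 + (f r 2)\<^sup>2 + (f r 4)\<^sup>2 + (f r 7)\<^sup>2)" for r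
    by (rule sum_13) (simp add: inv)
  have "(\<Sum>r\<in>UNIV. \<Sum>s\<in>UNIV. (f r s)\<^sup>2) = 81" using corr[of 0 0] by (simp add: power2_eq_square)
  moreover have "(\<Sum>r\<in>UNIV. \<Sum>s\<in>UNIV. (f r s)\<^sup>2)
      = (\<Sum>s\<in>UNIV. (f 0 s)\<^sup>2) + 5 * (\<Sum>s\<in>UNIV. (f 1 s)\<^sup>2) + 5 * (\<Sum>s\<in>UNIV. (f 2 s)\<^sup>2)"
    by (rule sum_11) (simp add: inv)
  ultimately have weight: "(f 0 0)\<^sup>2 + 3 * ((f 0 1)\<^sup>2 + (f 0 2)\<^sup>2 + (f 0 4)\<^sup>2 + (f 0 7)\<^sup>2)
      + 5 * ((f 1 0)\<^sup>2 + 3 * ((f 1 1)\<^sup>2 + (f 1 2)\<^sup>2 + (f 1 4)\<^sup>2 + (f 1 7)\<^sup>2))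
      + 5 * ((f 2 0)\<^sup>2 + 3 * ((f 2 1)\<^sup>2 + (f 2 2)\<^sup>2 + (f 2 4)\<^sup>2 + (f 2 7)\<^sup>2)) = 81"
    by (simp only: sq_rows)
  have "\<alpha> 0 + 5 * \<alpha> 1 + 5 * \<alpha> 2 = 9"
    using total sum_11[of \<alpha>, OF \<alpha>3] by (simp only: \<alpha>_def)
  then have total': "f 0 0 + 3 * (f 0 1 + f 0 2 + f 0 4 + f 0 7) + 5 * (f 1 0 + 3 * (f 1 1 + f 1 2 + f 1 4 + f 1 7))
      + 5 * (f 2 0 + 3 * (f 2 1 + f 2 2 + f 2 4 + f 2 7)) = 9"
    by (simp only: \<alpha>)
  have w11: "(\<alpha> 0)\<^sup>2 + 5 * (\<alpha> 1)\<^sup>2 + 5 * (\<alpha> 2)\<^sup>2 = 81"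
    using weight11 sum_11[of "\<lambda>r. (\<alpha> r)\<^sup>2"] by (simp only: \<alpha>3)
  have w13: "(\<beta> 0)\<^sup>2 + 3 * ((\<beta> 1)\<^sup>2 + (\<beta> 2)\<^sup>2 + (\<beta> 4)\<^sup>2 + (\<beta> 7)\<^sup>2) = 81"
    using corr13[of 0] sum_13[of "\<lambda>s. (\<beta> s)\<^sup>2"] by (simp add: \<beta>3 power2_eq_square)
  have "(\<Sum>s\<in>UNIV. \<beta> s * \<beta> (s + 1)) = 0" using corr13[of 1] by simp
  note c13 = this[unfolded correlation_13[of \<beta>, OF \<beta>3]]
  show False
    by (rule orbit_values_contradiction[OF small small small small small small small total' weight
      \<alpha> \<alpha> \<alpha> w11 \<beta> \<beta> \<beta> \<beta> \<beta> w13 c13])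
qed

text \<open>The sum of all autocorrelations is the square of the total, so the total is 9 or -9.
  Negating f keeps the autocorrelations and reduces -9 to 9.\<close>

lemma no_perfect_correlation:
  fixes f :: "11 \<Rightarrow> 13 \<Rightarrow> int"
  assumes inv: "\<And>r s. f (3 * r) s = f r s" "\<And>r s. f r (3 * s) = f r s"
    and small: "\<And>r s. (f r s)\<^sup>2 \<le> 1"
    and corr: "\<And>a b. (\<Sum>r\<in>UNIV. \<Sum>s\<in>UNIV. f r s * f (r + a) (s + b)) = (if a = 0 \<and> b = 0 then 81 else 0)"
  shows False
proof -
  have "(\<Sum>a\<in>UNIV. \<Sum>b\<in>UNIV. \<Sum>r\<in>UNIV. \<Sum>s\<in>UNIV. f r s * f (r + a) (s + b))
      = (\<Sum>a\<in>UNIV. \<Sum>r\<in>UNIV. \<Sum>b\<in>UNIV. \<Sum>s\<in>UNIV. f r s * f (r + a) (s + b))"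
    by (intro sum.cong refl sum.swap)
  also have "\<dots> = (\<Sum>r\<in>UNIV. \<Sum>s\<in>UNIV. f r s)\<^sup>2"
    by (simp only: sum_correlation sum_correlation[where g = "\<lambda>r. \<Sum>s\<in>UNIV. f r s" and h = "\<lambda>r. \<Sum>s\<in>UNIV. f r s"] power2_eq_square)
  also have "(\<Sum>a\<in>UNIV. \<Sum>b\<in>UNIV. \<Sum>r\<in>UNIV. \<Sum>s\<in>UNIV. f r s * f (r + a) (s + b)) = 81"
  proof -
    have "(if a = 0 \<and> b = 0 then 81 else 0) = (if a = 0 then if b = 0 then 81 else 0 else (0::int))" for a :: 11 and b :: 13
      by simp
    then have "(\<Sum>b\<in>UNIV. (if a = 0 \<and> b = (0::13) then 81 else (0::int))) = (if a = 0 then 81 else 0)" for a :: 11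
      by simp
    then show ?thesis unfolding corr by simp
  qed
  finally have "(\<Sum>r\<in>UNIV. \<Sum>s\<in>UNIV. f r s)\<^sup>2 = 9\<^sup>2" by simp
  then consider "(\<Sum>r\<in>UNIV. \<Sum>s\<in>UNIV. f r s) = 9" | "(\<Sum>r\<in>UNIV. \<Sum>s\<in>UNIV. f r s) = - 9"
    unfolding power2_eq_iff by blast
  then show False
  proof cases
    case 1
    with assms show False by (rule no_perfect_correlation_of_sum_9)
  next
    case 2
    show False
      by (rule no_perfect_correlation_of_sum_9[of "\<lambda>r s. - f r s"]) (simp_all add: assms sum_negf 2)
  qed
qed

lemma no_small_solution:
  fixes A :: "11 \<times> 13 \<Rightarrow>\<^sub>0 eisenstein"
  assumes A: "A * star A = 81" and small: "\<And>g. eis_norm (lookup A g) \<le> 1"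
  shows False
proof -
  obtain g0 x where x: "eis_norm x = 1" and mult: "theta A = Poly_Mapping.single g0 x * A"
    using multiplier[OF A] by blast
  \<comment> \<open>Half of g0: 6 and 7 invert 2 modulo 11 and 13. Translating by c absorbs g0,
    since 3c - g0 = c.\<close>
  define c where "c = (6 * fst g0, 7 * snd g0)"
  have c: "triple c - g0 = c"
  proof -
    have "3 * (6 * r) - r = 6 * r" for r :: 11
    proof -
      have "3 * (6 * r) - r = 17 * r" by (simp add: algebra_simps)
      moreover have "(17::11) = 6" by simp
      ultimately show ?thesis by (simp only:)
    qed
    moreover have "3 * (7 * s) - s = 7 * s" for s :: 13
    proof -
      have "3 * (7 * s) - s = 20 * s" by (simp add: algebra_simps)
      moreover have "(20::13) = 7" by simp
      ultimately show ?thesis by (simp only:)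
    qed
    ultimately show ?thesis by (simp add: c_def triple_eq prod_eq_iff)
  qed
  define B where "B g = lookup A (g + c)" for g
  have conj_B: "eis_conj (B g) = x * B (triple g)" for g
  proof -
    have "eis_conj (B g) = lookup (theta A) (triple (g + c))" by (simp add: B_def lookup_star_map[OF inj_triple])
    also have "\<dots> = x * lookup A (triple g + (triple c - g0))"
      by (simp only: mult lookup_single_mult triple_add add_diff_eq)
    finally show ?thesis by (simp only: c B_def)
  qed
  \<comment> \<open>Two applications of \<open>conj_B\<close> cancel the conjugation and contribute
    \<open>x * eis_conj x\<close>, which is 1.\<close>
  have B9: "B (9 * r, 9 * s) = B (r, s)" for r s
  proof -
    have "B (triple (triple g)) = B g" for g
    proof -
      have "B g = eis_conj (eis_conj (B g))" by simp
      also have "\<dots> = eis_conj x * (x * B (triple (triple g)))"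
        by (simp only: conj_B eis_conj_mult)
      also have "\<dots> = (x * eis_conj x) * B (triple (triple g))" by (simp only: mult_ac)
      also have "\<dots> = B (triple (triple g))"
        by (simp add: mult_eis_conj x flip: one_eisenstein_def)
      finally show ?thesis ..
    qed
    from this[of "(r, s)"] show ?thesis by (simp add: triple_eq)
  qed
  have B_pow: "B (9 ^ n * r, 9 ^ n * s) = B (r, s)" for n r s
    by (induction n) (simp_all add: B9 mult.assoc)
  have B_inv: "B (3 * r, s) = B (r, s)" "B (r, 3 * s) = B (r, s)" for r s
  proof -
    \<comment> \<open>Suitable powers of 9 act as 3 on one factor and trivially on the other, so
      invariance holds in each factor separately.\<close>
    have "(9::11) ^ 3 = 3" "(9::13) ^ 3 = 1" "(9::11) ^ 5 = 1" "(9::13) ^ 5 = 3" by simp_all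
    with B_pow[of 3 r s] B_pow[of 5 r s] show "B (3 * r, s) = B (r, s)" "B (r, 3 * s) = B (r, s)"
      by (simp_all only: mult_1)
  qed
  have conj_B': "eis_conj (B g) = x * B g" for g
    using conj_B[of g] by (cases g) (simp add: triple_eq B_inv)
  have "Eis (\<Sum>h\<in>UNIV. eis_norm (lookup A h)) 0 = 81"
    unfolding sum_norm_lookup[symmetric] A by (simp add: lookup_numeral)
  then have "(\<Sum>h\<in>UNIV. eis_norm (lookup A h)) \<noteq> 0" by (auto simp: numeral_eisenstein)
  then obtain h where "eis_norm (lookup A h) \<noteq> 0" by (metis sum.neutral)
  then have "eis_norm (lookup A h) = 1" using small[of h] eis_norm_nonneg[of "lookup A h"] by linarith
  then obtain u g1 where u: "eis_norm u = 1" "u = B g1" unfolding B_def by (metis diff_add_cancel)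
  have uu: "u * eis_conj u = 1" by (simp add: mult_eis_conj u(1) one_eisenstein_def)
  \<comment> \<open>All values of B, including the unit u, satisfy
    \<open>eis_conj z = x * z\<close>. Dividing by u therefore makes them real, that is,
    integers.\<close>
  define f where "f g = fst_part (B g * eis_conj u)" for g
  have f: "B g * eis_conj u = Eis (f g) 0" for g
  proof -
    have "eis_conj (B g * eis_conj u) = (x * B g) * u" by (simp add: eis_conj_mult conj_B')
    also have "\<dots> = B g * eis_conj u" using conj_B'[of g1] by (simp add: u(2) mult_ac)
    finally show ?thesis unfolding f_def by (rule eis_conj_eq_self)
  qed
  have f_sq: "(f g)\<^sup>2 \<le> 1" for g
  proof -
    have "(f g)\<^sup>2 = eis_norm (B g * eis_conj u)" by (simp add: f eis_norm_def)
    then show ?thesis using small[of "g + c"] by (simp add: eis_norm_mult u(1) B_def)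
  qed
  have f_corr: "(\<Sum>g\<in>UNIV. f g * f (g + t)) = (if t = 0 then 81 else 0)" for t
  proof -
    have "Eis (\<Sum>g\<in>UNIV. f g * f (g + t)) 0 = (\<Sum>g\<in>UNIV. B g * eis_conj (B (g + t)))"
      unfolding sum_Eis_zero[symmetric]
    proof (rule sum.cong[OF refl])
      fix g
      have "Eis (f g * f (g + t)) 0 = Eis (f g) 0 * eis_conj (Eis (f (g + t)) 0)"
        by (simp add: eis_conj_def eisenstein_simps)
      also have "\<dots> = B g * eis_conj (B (g + t)) * (u * eis_conj u)"
        by (simp only: f[symmetric] eis_conj_mult eis_conj_conj mult_ac)
      finally show "Eis (f g * f (g + t)) 0 = B g * eis_conj (B (g + t))" by (simp add: uu)
    qed
    also have "\<dots> = (\<Sum>g\<in>UNIV. lookup A (c + g) * eis_conj (lookup A (c + g - (- t))))"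
      by (simp add: B_def algebra_simps)
    also have "\<dots> = lookup (A * star A) (- t)"
      unfolding lookup_mult_star by (rule sum_translate)
    also have "\<dots> = (if t = 0 then 81 else 0)" by (simp add: A lookup_numeral when_def)
    finally show ?thesis by (simp add: numeral_eisenstein eisenstein_simps split: if_splits)
  qed
  show False
  proof (rule no_perfect_correlation[of "\<lambda>r s. f (r, s)"])
    fix a :: 11 and b :: 13
    have "(\<Sum>r\<in>UNIV. \<Sum>s\<in>UNIV. f (r, s) * f (r + a, s + b)) = (\<Sum>g\<in>UNIV. f g * f (g + (a, b)))"
      by (simp add: sum.cartesian_product UNIV_Times_UNIV[symmetric] case_prod_unfold plus_prod_def
          del: UNIV_Times_UNIV)
    then show "(\<Sum>r\<in>UNIV. \<Sum>s\<in>UNIV. f (r, s) * f (r + a, s + b)) = (if a = 0 \<and> b = 0 then 81 else 0)"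
      by (simp add: f_corr prod_eq_iff)
  qed (simp_all add: f_def B_inv f_sq[unfolded f_def])
qed

section \<open>Difference sets\<close>

text \<open>The image of the residue class of n modulo 429, the factor \<open>\<int>/3\<close> being sent to powers of \<open>\<omega>\<close>.\<close>

definition residue_image :: "nat \<Rightarrow> (11 \<times> 13 \<Rightarrow>\<^sub>0 eisenstein)" where
  "residue_image n = Poly_Mapping.single (of_nat n, of_nat n) (omega ^ n)"

lemma residue_image_add: "residue_image (m + n) = residue_image m * residue_image n"
  by (simp add: residue_image_def mult_single power_add)

lemma residue_image_0: "residue_image 0 = 1"
  using single_one[where 'a = "11 \<times> 13" and 'b = eisenstein] by (simp add: residue_image_def zero_prod_def)

lemma residue_image_143: "residue_image 143 = Poly_Mapping.single 0 (omega ^ 2)"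
proof -
  have "omega ^ 143 = (omega ^ 3) ^ 47 * omega ^ 2" by (simp flip: power_mult power_add)
  moreover have "of_nat 143 = (0::11)" "of_nat 143 = (0::13)" by simp_all
  ultimately show ?thesis unfolding residue_image_def zero_prod_def by (simp only: omega_pow_3 power_one mult_1)
qed

lemma residue_image_429: "residue_image 429 = 1"
proof -
  have "residue_image 429 = residue_image 143 * residue_image 143 * residue_image 143" by (simp flip: residue_image_add)
  also have "\<dots> = Poly_Mapping.single 0 ((omega ^ 3) ^ 2)"
    by (simp add: residue_image_143 mult_single flip: power_add power_mult)
  finally show ?thesis by (simp add: omega_pow_3)
qed

lemma residue_image_mod: "residue_image (n mod 429) = residue_image n"
proof -
  have "residue_image (429 * q + m) = residue_image m" for q m
    by (induction q) (simp_all add: residue_image_add residue_image_429)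
  from this[of "n div 429" "n mod 429"] show ?thesis by simp
qed

text \<open>A nontrivial character kills the sum of the group: the three blocks of length 143 are
  multiples of the first, with factors adding up to 1 + \<omega>^2 + \<omega>^4 = 0.\<close>

lemma sum_residue_image: "(\<Sum>n<429. residue_image n) = 0"
proof -
  let ?S = "\<Sum>n<143. residue_image n"
  have shift: "(\<Sum>n\<in>{k..<k + 143}. residue_image n) = residue_image k * ?S" for k
    unfolding sum_distrib_left residue_image_add[symmetric]
    by (rule sum.reindex_bij_witness[of _ "\<lambda>n. k + n" "\<lambda>n. n - k"]) auto
  have "(\<Sum>n<429. residue_image n) = (\<Sum>i<3. \<Sum>n\<in>{i * 143..<i * 143 + 143}. residue_image n)"
    using sum.nat_group[of residue_image 143 3] by simp
  also have "\<dots> = (1 + residue_image 143 + residue_image 143 * residue_image 143) * ?S"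
    unfolding shift by (simp add: numeral_3_eq_3 residue_image_0 algebra_simps flip: residue_image_add)
  also have "1 + residue_image 143 + residue_image 143 * residue_image 143 = Poly_Mapping.single 0 (1 + omega ^ 2 + omega ^ 2 * omega ^ 2)"
    by (simp add: residue_image_143 mult_single single_add)
  also have "1 + omega ^ 2 + omega ^ 2 * omega ^ 2 = 0"
    by (simp add: omega_def eisenstein_simps power2_eq_square)
  finally show ?thesis by simp
qed

text \<open>\<open>star\<close> inverts a group element multiplied by a root of unity.\<close>

lemma residue_image_mult_star: "residue_image m * star (residue_image n) = residue_image (nat ((int m - int n) mod 429))"
proof -
  have "residue_image n * star (residue_image n) = 1"
  proof -
    have "(omega * eis_conj omega) ^ n = 1"
      by (simp add: omega_def eis_conj_def eisenstein_simps flip: one_eisenstein_def)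
    moreover have "eis_conj (omega ^ n) = eis_conj omega ^ n" by (induction n) (simp_all add: eis_conj_mult)
    ultimately show ?thesis by (simp add: residue_image_def mult_single zero_prod_def[symmetric] power_mult_distrib)
  qed
  let ?k = "nat ((int m - int n) mod 429)"
  have "int ((?k + n) mod 429) = int (m mod 429)"
    by (simp add: zmod_int mod_simps)
  then have "residue_image m = residue_image (?k + n)" by (metis residue_image_mod of_nat_eq_iff)
  then show ?thesis using \<open>residue_image n * star (residue_image n) = 1\<close> by (simp add: residue_image_add mult.assoc)
qed

text \<open>Zero is a difference 108 = 27 + 81 times and every other class 27 times. The 27 copies
  of the whole group have image 0, so 81 remains.\<close>

lemma difference_set_mult_star:
  assumes D: "D \<subseteq> {0..<429}" "card D = 108"
    and diff: "\<And>g. g \<in> {1..<429} \<Longrightarrow> card {(x, y). x \<in> D \<and> y \<in> D \<and> g = (x - y) mod 429} = 27"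
  shows "(\<Sum>d\<in>D. residue_image (nat d)) * star (\<Sum>d\<in>D. residue_image (nat d)) = 81"
proof -
  let ?\<delta> = "\<lambda>p. (fst p - snd p) mod (429::int)"
  have fin: "finite D" using D(1) by (rule finite_subset) simp
  have "(\<Sum>d\<in>D. residue_image (nat d)) * star (\<Sum>d\<in>D. residue_image (nat d))
      = (\<Sum>d\<in>D. \<Sum>e\<in>D. residue_image (nat d) * star (residue_image (nat e)))"
    by (simp add: star_map_sum sum_product)
  also have "\<dots> = (\<Sum>d\<in>D. \<Sum>e\<in>D. residue_image (nat (?\<delta> (d, e))))"
    by (intro sum.cong refl) (use D(1) in \<open>auto simp: residue_image_mult_star subset_iff\<close>)
  also have "\<dots> = (\<Sum>p\<in>D \<times> D. residue_image (nat (?\<delta> p)))"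
    by (simp add: sum.cartesian_product case_prod_unfold)
  also have "\<dots> = (\<Sum>g\<in>{0..<429}. \<Sum>p\<in>{p \<in> D \<times> D. ?\<delta> p = g}. residue_image (nat (?\<delta> p)))"
    by (rule sum.group[symmetric]) (use fin in auto)
  also have "\<dots> = (\<Sum>g\<in>{0..<429}. of_nat (card {p \<in> D \<times> D. ?\<delta> p = g}) * residue_image (nat g))"
    by (rule sum.cong) simp_all
  also have "\<dots> = (\<Sum>g\<in>{0..<429}. 27 * residue_image (nat g) + (if g = 0 then 81 else 0))"
  proof (rule sum.cong[OF refl])
    fix g :: int
    assume g: "g \<in> {0..<429}"
    show "of_nat (card {p \<in> D \<times> D. ?\<delta> p = g}) * residue_image (nat g) = 27 * residue_image (nat g) + (if g = 0 then 81 else 0)"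
    proof (cases "g = 0")
      case True
      have diag: "x = y" if "x \<in> D" "y \<in> D" "(x - y) mod 429 = 0" for x y
      proof -
        have "0 \<le> x" "x < 429" "0 \<le> y" "y < 429" using that D(1) by auto
        moreover have "x mod 429 = y mod 429" using that(3) by (simp add: mod_eq_dvd_iff mod_eq_0_iff_dvd)
        ultimately show ?thesis by simp
      qed
      have "{p \<in> D \<times> D. ?\<delta> p = g} = (\<lambda>x. (x, x)) ` D"
      proof (intro equalityI subsetI)
        fix p
        assume p: "p \<in> {p \<in> D \<times> D. ?\<delta> p = g}"
        then have "fst p = snd p" using diag[of "fst p" "snd p"] True by auto
        then show "p \<in> (\<lambda>x. (x, x)) ` D" using p by (cases p) auto
      qed (use True in auto)
      then have "card {p \<in> D \<times> D. ?\<delta> p = g} = 108"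
        by (simp add: card_image inj_on_def D(2))
      then show ?thesis by (simp add: True residue_image_0)
    next
      case False
      have "{p \<in> D \<times> D. ?\<delta> p = g} = {(x, y). x \<in> D \<and> y \<in> D \<and> g = (x - y) mod 429}" by auto
      then show ?thesis using diff[of g] g False by simp
    qed
  qed
  also have "\<dots> = 27 * (\<Sum>g\<in>{0..<429}. residue_image (nat g)) + 81"
    by (simp add: sum.distrib sum_distrib_left)
  also have "(\<Sum>g\<in>{0..<429}. residue_image (nat g)) = (\<Sum>n<429. residue_image n)"
    by (rule sum.reindex_bij_witness[of _ int nat]) auto
  finally show ?thesis by (simp add: sum_residue_image)
qed

lemma of_nat_pair_eq_iff: "((of_nat m, of_nat m) :: 11 \<times> 13) = (of_nat n, of_nat n) \<longleftrightarrow> m mod 143 = n mod 143"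
proof -
  have "(of_nat m :: 11) = of_nat n \<longleftrightarrow> m mod 11 = n mod 11"
    by (simp add: of_nat_eq_iff_cong_CHAR cong_def)
  moreover have "(of_nat m :: 13) = of_nat n \<longleftrightarrow> m mod 13 = n mod 13"
    by (simp add: of_nat_eq_iff_cong_CHAR cong_def)
  moreover have "m mod 143 = n mod 143 \<longleftrightarrow> m mod 11 = n mod 11 \<and> m mod 13 = n mod 13"
  proof -
    have "coprime (11::nat) 13" by (simp add: coprime_iff_gcd_eq_1 gcd_non_0_nat)
    then show ?thesis
      using coprime_cong_mult_nat[of m n 11 13] cong_modulus_mult_nat[of m n 11 13] cong_modulus_mult_nat[of m n 13 11]
      by (auto simp: cong_def)
  qed
  ultimately show ?thesis by simp
qed

text \<open>The coefficient at g collects the members of D in one class modulo 143. There are at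
  most three below 429, and they contribute distinct cube roots of unity.\<close>

lemma eis_norm_lookup_sum_residue_image:
  assumes "D \<subseteq> {0..<429}"
  shows "eis_norm (lookup (\<Sum>d\<in>D. residue_image (nat d)) g) \<le> 1"
proof -
  define N where "N = {n \<in> nat ` D. (of_nat n, of_nat n) = g}"
  have fin: "finite (nat ` D)" using assms finite_subset by blast
  have "inj_on nat D" using assms by (auto intro!: inj_onI simp: subset_iff eq_nat_nat_iff)
  then have "(\<Sum>d\<in>D. residue_image (nat d)) = (\<Sum>n\<in>nat ` D. residue_image n)" by (simp add: sum.reindex)
  then have "lookup (\<Sum>d\<in>D. residue_image (nat d)) g = (\<Sum>n\<in>nat ` D. if (of_nat n, of_nat n) = g then omega ^ n else 0)"
    by (simp add: lookup_sum residue_image_def lookup_single when_def)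
  also have "\<dots> = (\<Sum>n\<in>N. omega ^ n)" unfolding N_def by (rule sum.inter_filter[symmetric, OF fin])
  finally have eq: "lookup (\<Sum>d\<in>D. residue_image (nat d)) g = (\<Sum>n\<in>N. omega ^ n)" .
  show ?thesis
  proof (cases "N = {}")
    case True
    then show ?thesis by (simp add: eq eis_norm_def zero_eisenstein_def)
  next
    case False
    then obtain n0 where n0: "n0 \<in> N" by blast
    define m where "m = n0 mod 143"
    define J where "J = {j \<in> {0,1,2}. m + 143 * j \<in> N}"
    have J: "J \<subseteq> {0,1,2}" by (auto simp: J_def)
    have N: "n div 143 \<in> {0,1,2} \<and> n = m + 143 * (n div 143)" if "n \<in> N" for n
    proof -
      have "((of_nat n, of_nat n) :: 11 \<times> 13) = (of_nat n0, of_nat n0)" using that n0 by (simp add: N_def)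
      then have "n mod 143 = m" by (simp only: of_nat_pair_eq_iff m_def)
      moreover have "n < 429" using that assms by (force simp: N_def)
      then have "n div 143 < 3" by (simp add: less_mult_imp_div_less)
      then have "n div 143 \<in> {0,1,2}" by auto
      ultimately show ?thesis using mod_mult_div_eq[of n 143] by simp
    qed
    have "(\<Sum>n\<in>N. omega ^ n) = (\<Sum>j\<in>J. omega ^ (m + 143 * j))"
      by (rule sum.reindex_bij_witness[of _ "\<lambda>j. m + 143 * j" "\<lambda>n. n div 143"])
        (use N in \<open>auto simp: J_def m_def\<close>)
    also have "\<dots> = omega ^ m * (\<Sum>j\<in>J. omega ^ (2 * j))"
    proof -
      have "omega ^ (143 * j) = (omega ^ 3) ^ (47 * j) * omega ^ (2 * j)" for j
        by (simp flip: power_mult power_add)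
      then show ?thesis by (simp add: power_add sum_distrib_left omega_pow_3)
    qed
    finally have "eis_norm (\<Sum>n\<in>N. omega ^ n) = eis_norm (omega ^ m) * eis_norm (\<Sum>j\<in>J. omega ^ (2 * j))"
      by (simp add: eis_norm_mult)
    moreover have "eis_norm (omega ^ m) = 1"
      by (induction m) (simp_all add: eis_norm_mult, simp_all add: eis_norm_def omega_def one_eisenstein_def)
    ultimately show ?thesis using eis_norm_omega_sum[of J] J by (simp add: eq)
  qed
qed

theorem theorem7:
  shows "\<not> (\<exists>D. cyclic_difference_set 429 108 27 D)"
proof
  assume "\<exists>D. cyclic_difference_set 429 108 27 D"
  then obtain D where "cyclic_difference_set 429 108 27 D" ..
  then have D: "D \<subseteq> {0..<429}" "card D = 108"
    "g \<in> {1..<429} \<Longrightarrow> card {(x, y). x \<in> D \<and> y \<in> D \<and> g = (x - y) mod 429} = 27" for g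
    by (simp_all add: cyclic_difference_set_iff)
  show False
    by (rule no_small_solution[OF difference_set_mult_star[OF D] eis_norm_lookup_sum_residue_image[OF D(1)]])
qed

end
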